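(* Let $r>0$, let $\omega\in\mathbb{R}^n$ and $E=\{x\in\mathbb{R}^n:\ x\cdot\omega<0\}$. Then $E$ is a Class A minimizer for $\mathrm{Per}_r$.
   Context: $B_\rho(x)$ is the ball of radius $\rho$ centered at $x$ in $\mathbb{R}^n$, and $\mathcal{L}^n$ is the $n$-dimensional Lebesgue measure. For $A\subseteq\mathbb{R}^n$, $A\oplus B_r:=\bigcup_{x\in A}B_r(x)$ and $A\ominus B_r:=A\setminus\big((\partial A)\oplus B_r\big)$. Measurable sets are identified with their sets of points of density one (so equalities of sets are up to null sets), and $\partial E$ denotes the topological boundary of the set of points of density one of $E$. For a domain $\Omega$ and measurable $E\subseteq\mathbb{R}^n$, $$\mathrm{Per}_r(E,\Omega):=\frac{1}{2r}\mathcal{L}^n\Big(\big((\partial E)\oplus B_r\big)\cap\Omega\Big).$$ A set $E$ is a minimizer for $\mathrm{Per}_r$ in a bounded domain $\Omega$ if $\mathrm{Per}_r(E,\Omega)\le\mathrm{Per}_r(F,\Omega)$ for any measurable $F\subseteq\mathbb{R}^n$ with $F\setminus(\Omega\ominus B_r)=E\setminus(\Omega\ominus B_r)$. $E$ is a Class A minimizer if it is a minimizer in this sense in any ball of $\mathbb{R}^n$. *)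

theory Defs
  imports "HOL-Analysis.Analysis"
begin

definition oplus_ball :: "(real^'n) set \<Rightarrow> real \<Rightarrow> (real^'n) set" where
  "oplus_ball A r = (\<Union>x\<in>A. ball x r)"

definition ominus_ball :: "(real^'n) set \<Rightarrow> real \<Rightarrow> (real^'n) set" where
  "ominus_ball A r = A - oplus_ball (frontier A) r"

definition density_points :: "(real^'n) set \<Rightarrow> (real^'n) set" where
  "density_points E = {x. ((\<lambda>\<rho>. measure lebesgue (E \<inter> ball x \<rho>) / measure lebesgue (ball x \<rho>))
     \<longlongrightarrow> 1) (at_right 0)}"

(* The boundary of a measurable set regarded as an equivalence class modulo null sets:
   the topological boundary of its density-one representative. *)
definition density_frontier :: "(real^'n) set \<Rightarrow> (real^'n) set" where
  "density_frontier E = frontier (density_points E)"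

(* Valued in the extended nonnegative reals, since the measure may be infinite
   when \<Omega> is unbounded. *)
definition Per :: "real \<Rightarrow> (real^'n) set \<Rightarrow> (real^'n) set \<Rightarrow> ennreal" where
  "Per r E \<Omega> = ennreal (1 / (2 * r)) * emeasure lebesgue (oplus_ball (density_frontier E) r \<inter> \<Omega>)"

(* The competitor F agrees with E outside ominus_ball \<Omega> r up to a null set, because
   measurable sets are identified with their density-one representatives. *)
definition Per_minimizer :: "real \<Rightarrow> (real^'n) set \<Rightarrow> (real^'n) set \<Rightarrow> bool" where
  "Per_minimizer r \<Omega> E \<longleftrightarrow>
     open \<Omega> \<and> connected \<Omega> \<and> \<Omega> \<noteq> {} \<and> bounded \<Omega> \<and> E \<in> sets lebesgue \<and>
     (\<forall>F \<in> sets lebesgue.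
        (AE x in lebesgue. x \<in> F - ominus_ball \<Omega> r \<longleftrightarrow> x \<in> E - ominus_ball \<Omega> r) \<longrightarrow>
        Per r E \<Omega> \<le> Per r F \<Omega>)"

definition class_A_minimizer :: "real \<Rightarrow> (real^'n) set \<Rightarrow> bool" where
  "class_A_minimizer r E \<longleftrightarrow> (\<forall>c R. R > 0 \<longrightarrow> Per_minimizer r (ball c R) E)"

end

theory Submission imports Defs begin

text \<open>
  The half-space beats every competitor on each line orthogonal to its boundary hyperplane \<open>H\<close>,
  and the lines are then put together by Fubini's theorem.

  Let \<open>w\<close> be the unit normal, \<open>\<Omega>\<close> the ball of radius \<open>R\<close> about \<open>c\<close>, and \<open>K\<close> the closed ball of radius
  \<open>R - r\<close> about \<open>c\<close>, which contains \<open>\<Omega> \<ominus> B\<^sub>r\<close>. Up to a null set, a competitor \<open>F\<close> is the half-space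
  off \<open>K\<close>, so its density-one representative \<open>D\<close> contains \<open>{x \<bullet> w < 0} - K\<close> and misses
  \<open>{x \<bullet> w > 0} - K\<close>. Hence off \<open>K\<close> the frontier of \<open>D\<close> is exactly \<open>H\<close>
  (\<open>frontier_subset_hyperplane\<close>, \<open>hyperplane_subset_frontier\<close>). Consider a line in direction \<open>w\<close>,
  meeting \<open>H\<close> in the single point \<open>y\<close>.

  If \<open>y \<notin> K\<close>, then \<open>y\<close> is itself a frontier point of \<open>D\<close>. The half-space contributes on this
  line only points within distance \<open>r\<close> of \<open>y\<close>, and all of these lie in the \<open>r\<close>-neighbourhood of
  the frontier of \<open>D\<close> as well.

  If \<open>y \<in> K\<close>, then the line starts in \<open>D\<close> and ends outside \<open>D\<close>, so it crosses the frontier of \<open>D\<close>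
  at some point \<open>p\<close>, and \<open>p \<in> K\<close> because off \<open>K\<close> the only candidate would be \<open>y\<close>. By the triangle
  inequality the whole segment of length \<open>2 r\<close> centred at \<open>p\<close> lies in \<open>\<Omega>\<close>. So \<open>F\<close> contributes
  at least \<open>2 r\<close> on this line, which is the most that the half-space can contribute.
\<close>

section \<open>Integration over parallel lines\<close>

text \<open>
  Tonelli's theorem in an arbitrary direction, without a choice of coordinates: instead of
  integrating the lengths of slices over the hyperplane orthogonal to \<open>w\<close>, integrate them over a
  slab of thickness one. Each line meets the slab in a segment of length one, and all points of
  that segment see the same slice up to a translation.
\<close>

lemma emeasure_lborel_eq_integral_slices:
  fixes S :: "'a::euclidean_space set"
  assumes w: "norm w = 1" and S: "S \<in> sets borel"
  shows "emeasure lborel S =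
    (\<integral>\<^sup>+x. indicator {x. 0 \<le> x \<bullet> w \<and> x \<bullet> w < 1} x * emeasure lborel {t. x + t *\<^sub>R w \<in> S} \<partial>lborel)"
proof -
  define W where "W = {x. 0 \<le> x \<bullet> w \<and> x \<bullet> w < 1}"
  have W: "W \<in> sets borel"
    unfolding W_def by measurable
  note [measurable] = S W
  have ww: "w \<bullet> w = 1"
    using w by (simp add: dot_square_norm)
  have len: "(\<integral>\<^sup>+t. indicator W (x - t *\<^sub>R w) \<partial>lborel) = 1" for x :: 'a
  proof -
    have "(\<lambda>t. indicator W (x - t *\<^sub>R w) :: ennreal) = indicator {x \<bullet> w - 1 <.. x \<bullet> w}"
      by (auto simp: W_def indicator_def inner_diff_left ww fun_eq_iff)
    then show ?thesis
      by simp
  qed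
  have slice: "(\<integral>\<^sup>+t. indicator S (x + t *\<^sub>R w) \<partial>lborel) = emeasure lborel {t. x + t *\<^sub>R w \<in> S}"
    for x :: 'a
  proof -
    have [measurable]: "{t. x + t *\<^sub>R w \<in> S} \<in> sets borel"
      by measurable
    have "(\<lambda>t. indicator S (x + t *\<^sub>R w) :: ennreal) = indicator {t. x + t *\<^sub>R w \<in> S}"
      by (auto simp: indicator_def)
    then show ?thesis
      by simp
  qed
  have shift: "(\<integral>\<^sup>+x. indicator W x * indicator S (x + t *\<^sub>R w) \<partial>lborel)
      = (\<integral>\<^sup>+x. indicator W (x - t *\<^sub>R w) * indicator S x \<partial>lborel)" (is "?l = ?r") for t :: real
  proof -
    have "?r = (\<integral>\<^sup>+x. indicator W (x - t *\<^sub>R w) * indicator S x \<partial>distr lborel borel ((+) (t *\<^sub>R w)))"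
      by (simp only: lborel_distr_plus)
    also have "\<dots> = (\<integral>\<^sup>+x. indicator W (t *\<^sub>R w + x - t *\<^sub>R w) * indicator S (t *\<^sub>R w + x) \<partial>lborel)"
      by (subst nn_integral_distr) auto
    also have "\<dots> = ?l"
      by (simp add: add.commute)
    finally show ?thesis
      by simp
  qed
  have "(\<integral>\<^sup>+x. indicator W x * emeasure lborel {t. x + t *\<^sub>R w \<in> S} \<partial>lborel)
      = (\<integral>\<^sup>+x. \<integral>\<^sup>+t. indicator W x * indicator S (x + t *\<^sub>R w) \<partial>lborel \<partial>lborel)"
    by (simp add: slice[symmetric] nn_integral_cmult)
  also have "\<dots> = (\<integral>\<^sup>+t. \<integral>\<^sup>+x. indicator W x * indicator S (x + t *\<^sub>R w) \<partial>lborel \<partial>lborel)"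
    by (rule lborel_pair.Fubini') measurable
  also have "\<dots> = (\<integral>\<^sup>+t. \<integral>\<^sup>+x. indicator W (x - t *\<^sub>R w) * indicator S x \<partial>lborel \<partial>lborel)"
    by (simp only: shift)
  also have "\<dots> = (\<integral>\<^sup>+x. \<integral>\<^sup>+t. indicator W (x - t *\<^sub>R w) * indicator S x \<partial>lborel \<partial>lborel)"
    by (rule lborel_pair.Fubini') measurable
  also have "\<dots> = (\<integral>\<^sup>+x. indicator S x \<partial>lborel)"
    by (simp add: nn_integral_multc len)
  also have "\<dots> = emeasure lborel S"
    by simp
  finally show ?thesis
    by (simp add: W_def)
qed

lemma emeasure_lborel_mono_slices:
  fixes S T :: "'a::euclidean_space set"
  assumes w: "norm w = 1" and S: "S \<in> sets borel" and T: "T \<in> sets borel"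
    and le: "\<And>x. emeasure lborel {t. x + t *\<^sub>R w \<in> S} \<le> emeasure lborel {t. x + t *\<^sub>R w \<in> T}"
  shows "emeasure lborel S \<le> emeasure lborel T"
  unfolding emeasure_lborel_eq_integral_slices[OF w S] emeasure_lborel_eq_integral_slices[OF w T]
  by (intro nn_integral_mono mult_left_mono le) simp

section \<open>Density points\<close>

lemma eventually_ball_subset_at_right:
  fixes x :: "'a::metric_space"
  assumes "open U" "x \<in> U"
  shows "\<forall>\<^sub>F \<rho> in at_right (0::real). 0 < \<rho> \<and> ball x \<rho> \<subseteq> U"
proof -
  obtain e where "e > 0" "ball x e \<subseteq> U"
    using assms by (auto simp: open_contains_ball)
  then show ?thesis
    unfolding eventually_at_right_field by (intro exI[of _ e]) auto
qed

lemma in_density_points_if_AE: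
  fixes F :: "(real^'n) set"
  assumes F: "F \<in> sets lebesgue" and U: "open U" "x \<in> U"
    and ae: "AE z in lebesgue. z \<in> U \<longrightarrow> z \<in> F"
  shows "x \<in> density_points F"
proof -
  have "\<forall>\<^sub>F \<rho> in at_right 0. measure lebesgue (F \<inter> ball x \<rho>) / measure lebesgue (ball x \<rho>) = 1"
    using eventually_ball_subset_at_right[OF U]
  proof eventually_elim
    case (elim \<rho>)
    have "measure lebesgue (F \<inter> ball x \<rho>) = measure lebesgue (ball x \<rho>)"
    proof (rule measure_eq_AE)
      show "AE z in lebesgue. z \<in> F \<inter> ball x \<rho> \<longleftrightarrow> z \<in> ball x \<rho>"
        using ae by eventually_elim (use elim in auto)
    qed (use F in auto)
    moreover have "measure lebesgue (ball x \<rho>) > 0"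
      using content_ball_pos[of \<rho> x] elim by simp
    ultimately show ?case
      by simp
  qed
  then show ?thesis
    unfolding density_points_def by (auto intro: tendsto_eventually)
qed

lemma not_in_density_points_if_AE:
  fixes F :: "(real^'n) set"
  assumes F: "F \<in> sets lebesgue" and U: "open U" "x \<in> U"
    and ae: "AE z in lebesgue. z \<in> U \<longrightarrow> z \<notin> F"
  shows "x \<notin> density_points F"
proof -
  have "\<forall>\<^sub>F \<rho> in at_right 0. measure lebesgue (F \<inter> ball x \<rho>) / measure lebesgue (ball x \<rho>) = 0"
    using eventually_ball_subset_at_right[OF U]
  proof eventually_elim
    case (elim \<rho>)
    have "measure lebesgue (F \<inter> ball x \<rho>) = measure lebesgue ({} :: (real^'n) set)"
    proof (rule measure_eq_AE)
      show "AE z in lebesgue. z \<in> F \<inter> ball x \<rho> \<longleftrightarrow> z \<in> {}"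
        using ae by eventually_elim (use elim in auto)
    qed (use F in auto)
    then show ?case
      by simp
  qed
  then have "((\<lambda>\<rho>. measure lebesgue (F \<inter> ball x \<rho>) / measure lebesgue (ball x \<rho>)) \<longlongrightarrow> 0) (at_right 0)"
    by (rule tendsto_eventually)
  then show ?thesis
    unfolding density_points_def
    using tendsto_unique[OF trivial_limit_at_right_real] by fastforce
qed

section \<open>Sets that are half-spaces off a closed set\<close>

lemma frontier_subset_hyperplane:
  fixes w :: "'a::real_inner"
  assumes K: "closed K"
    and lower: "{x. x \<bullet> w < 0} - K \<subseteq> D" and upper: "({x. 0 < x \<bullet> w} - K) \<inter> D = {}"
  shows "frontier D - K \<subseteq> {x. x \<bullet> w = 0}"
proof
  fix p assume p: "p \<in> frontier D - K"
  have open_lower: "open ({x. x \<bullet> w < 0} - K)"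
    using K by (intro open_Diff open_Collect_less continuous_intros)
  have open_upper: "open ({x. 0 < x \<bullet> w} - K)"
    using K by (intro open_Diff open_Collect_less continuous_intros)
  have "p \<notin> {x. x \<bullet> w < 0} - K"
    using p interior_maximal[OF lower open_lower] by (auto simp: frontier_def)
  moreover have "p \<notin> {x. 0 < x \<bullet> w} - K"
    using p open_Int_closure_eq_empty[OF open_upper, of D] upper by (auto simp: frontier_def)
  ultimately show "p \<in> {x. x \<bullet> w = 0}"
    using p by auto
qed

lemma hyperplane_subset_frontier:
  fixes w :: "'a::real_inner"
  assumes K: "closed K" and w: "w \<noteq> 0"
    and lower: "{x. x \<bullet> w < 0} - K \<subseteq> D" and upper: "({x. 0 < x \<bullet> w} - K) \<inter> D = {}"
  shows "{x. x \<bullet> w = 0} - K \<subseteq> frontier D"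
proof
  fix y assume y: "y \<in> {x. x \<bullet> w = 0} - K"
  have "(\<exists>x\<in>D. dist y x < e) \<and> (\<exists>x. x \<notin> D \<and> dist y x < e)" if "e > 0" for e
  proof -
    obtain d where d: "d > 0" "ball y d \<subseteq> - K"
      using K y by (metis ComplI DiffD2 open_Compl open_contains_ball)
    \<comment> \<open>step from \<open>y\<close> to either side of the hyperplane, by less than \<open>e\<close> and without meeting \<open>K\<close>\<close>
    define s where "s = min d e / (2 * norm w)"
    have s: "s > 0" "s * norm w < d" "s * norm w < e"
      using d that w by (auto simp: s_def)
    have "y - s *\<^sub>R w \<in> {x. x \<bullet> w < 0} - K" "y + s *\<^sub>R w \<in> {x. 0 < x \<bullet> w} - K"
      using y s d w by (auto simp: inner_diff_left inner_add_left subset_eq dist_norm)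
    moreover have "dist y (y - s *\<^sub>R w) < e" "dist y (y + s *\<^sub>R w) < e"
      using s by (auto simp: dist_norm)
    ultimately show ?thesis
      using lower upper by blast
  qed
  then show "y \<in> frontier D"
    by (simp add: frontier_straddle)
qed

text \<open>
  Points of the line that are far away lie off the bounded set \<open>K\<close>, in \<open>D\<close> on one side and outside
  \<open>D\<close> on the other; connectedness of the line does the rest.
\<close>

lemma line_meets_frontier:
  fixes w :: "'a::real_inner"
  assumes K: "bounded K" and w: "w \<noteq> 0"
    and lower: "{x. x \<bullet> w < 0} - K \<subseteq> D" and upper: "({x. 0 < x \<bullet> w} - K) \<inter> D = {}"
  obtains t where "y + t *\<^sub>R w \<in> frontier D"
proof -
  obtain B where B: "\<And>x. x \<in> K \<Longrightarrow> norm x \<le> B"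
    using K by (auto simp: bounded_iff)
  define L where "L = range (\<lambda>t. y + t *\<^sub>R w)"
  \<comment> \<open>\<open>s\<close> is so large that \<open>y \<plusminus> s w\<close> have norm above \<open>B\<close> and lie on opposite sides of the hyperplane\<close>
  define s where "s = (\<bar>B\<bar> + norm y + 1) / norm w"
  have sw: "s * norm w = \<bar>B\<bar> + norm y + 1"
    using w by (simp add: s_def)
  have s: "s > 0"
    unfolding s_def using w by (intro divide_pos_pos add_nonneg_pos add_nonneg_nonneg) auto
  have big: "norm (s *\<^sub>R w) = \<bar>B\<bar> + norm y + 1"
    using s sw by simp
  have "norm (y + s *\<^sub>R w) > B" "norm (y - s *\<^sub>R w) > B"
    using big norm_triangle_ineq2[of "s *\<^sub>R w" "- y"] norm_triangle_ineq2[of "s *\<^sub>R w" y]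
    by (auto simp: add.commute norm_minus_commute)
  then have notK: "y + s *\<^sub>R w \<notin> K" "y - s *\<^sub>R w \<notin> K"
    using B by (auto simp: not_le[symmetric])
  have yw: "\<bar>y \<bullet> w\<bar> < s * (w \<bullet> w)"
  proof -
    have "\<bar>y \<bullet> w\<bar> \<le> norm y * norm w"
      by (rule Cauchy_Schwarz_ineq2)
    also have "\<dots> < (s * norm w) * norm w"
      using w by (intro mult_strict_right_mono) (auto simp: sw)
    finally show ?thesis
      by (simp add: dot_square_norm power2_eq_square)
  qed
  have "y - s *\<^sub>R w \<in> {x. x \<bullet> w < 0} - K" "y + s *\<^sub>R w \<in> {x. 0 < x \<bullet> w} - K"
    using notK yw by (auto simp: inner_diff_left inner_add_left)
  then have "y + (- s) *\<^sub>R w \<in> D" "y + s *\<^sub>R w \<notin> D"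
    using lower upper by auto
  then have "L \<inter> D \<noteq> {}" "L - D \<noteq> {}"
    unfolding L_def by blast+
  moreover have "connected L"
    unfolding L_def by (intro connected_continuous_image continuous_intros) simp
  ultimately have "L \<inter> frontier D \<noteq> {}"
    by (rule connected_Int_frontier[rotated])
  then show thesis
    using that by (auto simp: L_def)
qed

section \<open>Enlarged and shrunk sets\<close>

lemma mem_oplus_ball: "x \<in> oplus_ball A r \<longleftrightarrow> (\<exists>a\<in>A. dist a x < r)"
  by (simp add: oplus_ball_def)

lemma open_oplus_ball: "open (oplus_ball A r)"
  by (auto simp: oplus_ball_def)

lemma oplus_ball_hyperplane_subset:
  fixes w :: "real^'n"
  assumes "norm w = 1"
  shows "oplus_ball {x. x \<bullet> w = 0} r \<subseteq> {x. \<bar>x \<bullet> w\<bar> < r}"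
proof
  fix x assume "x \<in> oplus_ball {x. x \<bullet> w = 0} r"
  then obtain a where a: "a \<bullet> w = 0" "norm (x - a) < r"
    by (auto simp: mem_oplus_ball dist_norm norm_minus_commute)
  have "\<bar>x \<bullet> w\<bar> = \<bar>(x - a) \<bullet> w\<bar>"
    using a by (simp add: inner_diff_left)
  also have "\<dots> \<le> norm (x - a) * norm w"
    by (rule Cauchy_Schwarz_ineq2)
  finally show "x \<in> {x. \<bar>x \<bullet> w\<bar> < r}"
    using a assms by simp
qed

lemma ominus_ball_ball_subset:
  fixes c :: "real^'n"
  assumes R: "R > 0"
  shows "ominus_ball (ball c R) r \<subseteq> cball c (R - r)"
proof
  fix x assume x: "x \<in> ominus_ball (ball c R) r"
  obtain u :: "real^'n" where u: "norm u = 1" "x = c + norm (x - c) *\<^sub>R u"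
  proof (cases "x = c")
    case True
    obtain u :: "real^'n" where "norm u = 1"
      using vector_choose_size[of 1] by auto
    with True show thesis
      using that by simp
  next
    case False
    show thesis
      by (rule that[of "sgn (x - c)"]) (use False in \<open>auto simp: norm_sgn sgn_div_norm\<close>)
  qed
  \<comment> \<open>the point of the sphere that is nearest to \<open>x\<close>\<close>
  define p where "p = c + R *\<^sub>R u"
  have "p \<in> frontier (ball c R)"
    using R u by (simp add: p_def dist_norm)
  then have far: "dist p x \<ge> r"
    using x by (auto simp: ominus_ball_def mem_oplus_ball not_less)
  have lt: "norm (x - c) < R"
    using x by (simp add: ominus_ball_def dist_norm norm_minus_commute)
  have "p - x = (R - norm (x - c)) *\<^sub>R u"
    using u(2) by (metis (no_types, opaque_lifting) add_diff_cancel_left p_def scaleR_left_diff_distrib)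
  then have "dist p x = R - norm (x - c)"
    using u(1) lt by (simp add: dist_norm)
  then show "x \<in> cball c (R - r)"
    using far by (simp add: dist_norm norm_minus_commute)
qed

section \<open>The comparison\<close>

text \<open>
  Here \<open>D\<close> stands for the density-one representative of the competitor. A line that crosses the
  hyperplane off \<open>cball c (R - r)\<close> is handled by inclusion of its slices. On any other line the
  slices need not be nested, but that of the slab has length at most \<open>2 r\<close> and that of the competitor
  at least \<open>2 r\<close>. If \<open>R < r\<close>, then the closed ball is empty and all lines are of the first kind.
\<close>

lemma slab_le_oplus_ball_frontier:
  fixes w c :: "real^'n" and D :: "(real^'n) set"
  assumes r: "r > 0" and w: "norm w = 1"
    and lower: "{x. x \<bullet> w < 0} - cball c (R - r) \<subseteq> D"
    and upper: "({x. 0 < x \<bullet> w} - cball c (R - r)) \<inter> D = {}"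
  shows "emeasure lborel ({x. \<bar>x \<bullet> w\<bar> < r} \<inter> ball c R)
    \<le> emeasure lborel (oplus_ball (frontier D) r \<inter> ball c R)" (is "emeasure lborel ?S \<le> emeasure lborel ?T")
proof (rule emeasure_lborel_mono_slices[OF w])
  have "open {x. \<bar>x \<bullet> w\<bar> < r}"
    by (intro open_Collect_less continuous_intros)
  then show "?S \<in> sets borel"
    by auto
  have openT: "open ?T"
    by (intro open_Int open_oplus_ball open_ball)
  then show "?T \<in> sets borel"
    by simp
  have w0: "w \<noteq> 0" and ww: "w \<bullet> w = 1"
    using w by (auto simp: dot_square_norm)
  fix x :: "real^'n"
  define t0 where "t0 = - (x \<bullet> w)"
  define y where "y = x + t0 *\<^sub>R w"
  have yw: "y \<bullet> w = 0"
    by (simp add: y_def t0_def inner_diff_left ww)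
  have S_slice: "{t. x + t *\<^sub>R w \<in> ?S} \<subseteq> {t. \<bar>t - t0\<bar> < r \<and> x + t *\<^sub>R w \<in> ball c R}"
    by (auto simp: t0_def inner_add_left ww add.commute)
  have line_dist: "dist (x + s *\<^sub>R w) (x + t *\<^sub>R w) = \<bar>t - s\<bar>" for s t
    using w by (simp add: dist_norm scaleR_left_diff_distrib[symmetric] abs_minus_commute)
  have "continuous_on UNIV (\<lambda>t. x + t *\<^sub>R w)"
    by (intro continuous_intros)
  then have "open {t. x + t *\<^sub>R w \<in> ?T}"
    using open_vimage[OF openT] by (auto simp: vimage_def)
  then have T_meas: "{t. x + t *\<^sub>R w \<in> ?T} \<in> sets lborel"
    by simp
  show "emeasure lborel {t. x + t *\<^sub>R w \<in> ?S} \<le> emeasure lborel {t. x + t *\<^sub>R w \<in> ?T}"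
  proof (cases "y \<in> cball c (R - r)")
    case False
    then have "y \<in> frontier D"
      using hyperplane_subset_frontier[OF closed_cball w0 lower upper] yw by auto
    then have "x + t *\<^sub>R w \<in> oplus_ball (frontier D) r" if "\<bar>t - t0\<bar> < r" for t
      using that line_dist[of t0 t] unfolding mem_oplus_ball y_def by metis
    then have "{t. x + t *\<^sub>R w \<in> ?S} \<subseteq> {t. x + t *\<^sub>R w \<in> ?T}"
      using S_slice by blast
    then show ?thesis
      using T_meas by (rule emeasure_mono)
  next
    case True
    obtain t1 where t1: "x + t1 *\<^sub>R w \<in> frontier D"
      using line_meets_frontier[OF bounded_cball w0 lower upper] by metis
    define p where "p = x + t1 *\<^sub>R w"
    have p: "p \<in> cball c (R - r)"
    proof (rule ccontr)
      assume "p \<notin> cball c (R - r)"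
      then have "p \<bullet> w = 0"
        using frontier_subset_hyperplane[OF closed_cball lower upper] t1 by (auto simp: p_def)
      then have "t1 = t0"
        by (simp add: p_def t0_def inner_add_left ww)
      then show False
        using True \<open>p \<notin> cball c (R - r)\<close> by (simp add: p_def y_def)
    qed
    have "emeasure lborel {t. x + t *\<^sub>R w \<in> ?S} \<le> emeasure lborel {t0 - r <..< t0 + r}"
      by (intro emeasure_mono order_trans[OF S_slice]) auto
    also have "\<dots> = emeasure lborel {t1 - r <..< t1 + r}"
      using r by simp
    also have "\<dots> \<le> emeasure lborel {t. x + t *\<^sub>R w \<in> ?T}"
    proof (rule emeasure_mono[OF _ T_meas], rule subsetI)
      fix t assume "t \<in> {t1 - r <..< t1 + r}"
      then have near: "dist p (x + t *\<^sub>R w) < r"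
        using line_dist[of t1 t] by (auto simp: p_def)
      then have "x + t *\<^sub>R w \<in> oplus_ball (frontier D) r"
        using t1 unfolding mem_oplus_ball p_def by blast
      moreover have "dist c (x + t *\<^sub>R w) < R"
        using near p dist_triangle[of c "x + t *\<^sub>R w" p] by simp
      ultimately show "t \<in> {t. x + t *\<^sub>R w \<in> ?T}"
        by simp
    qed
    finally show ?thesis .
  qed
qed

lemma Per_eq_lborel:
  assumes "open \<Omega>"
  shows "Per r E \<Omega> = ennreal (1 / (2 * r)) * emeasure lborel (oplus_ball (density_frontier E) r \<inter> \<Omega>)"
proof -
  have "oplus_ball (density_frontier E) r \<inter> \<Omega> \<in> sets borel"
    using assms by (intro borel_open open_Int open_oplus_ball)
  then show ?thesis
    by (simp add: Per_def)
qed

lemma Per_halfspace_le: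
  fixes w c :: "real^'n" and F :: "(real^'n) set"
  assumes r: "r > 0" and w: "norm w = 1" and F: "F \<in> sets lebesgue"
    and ae: "AE x in lebesgue. x \<notin> cball c (R - r) \<longrightarrow> (x \<in> F \<longleftrightarrow> x \<bullet> w < 0)"
  shows "Per r {x. x \<bullet> w < 0} (ball c R) \<le> Per r F (ball c R)"
proof -
  define E where "E = {x. x \<bullet> w < 0}"
  define K where "K = cball c (R - r)"
  have open_lower: "open ({x. x \<bullet> w < 0} - K')" if "closed K'" for K'
    using that by (intro open_Diff open_Collect_less continuous_intros)
  have open_upper: "open ({x. 0 < x \<bullet> w} - K')" if "closed K'" for K'
    using that by (intro open_Diff open_Collect_less continuous_intros)
  have E: "E \<in> sets lebesgue"
    using open_lower[of "{}"] by (simp add: E_def)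
  have E_lower: "{x. x \<bullet> w < 0} - {} \<subseteq> density_points E"
    using in_density_points_if_AE[OF E open_lower[of "{}"]] by (auto simp: E_def)
  have E_upper: "({x. 0 < x \<bullet> w} - {}) \<inter> density_points E = {}"
    using not_in_density_points_if_AE[OF E open_upper[of "{}"]] by (auto simp: E_def)
  have "AE x in lebesgue. x \<in> {x. x \<bullet> w < 0} - K \<longrightarrow> x \<in> F"
    using ae by eventually_elim (auto simp: K_def)
  then have F_lower: "{x. x \<bullet> w < 0} - K \<subseteq> density_points F"
    using in_density_points_if_AE[OF F open_lower[of K]] by (auto simp: K_def)
  have "AE x in lebesgue. x \<in> {x. 0 < x \<bullet> w} - K \<longrightarrow> x \<notin> F"
    using ae by eventually_elim (auto simp: K_def)
  then have F_upper: "({x. 0 < x \<bullet> w} - K) \<inter> density_points F = {}"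
    using not_in_density_points_if_AE[OF F open_upper[of K]] by (auto simp: K_def)
  have "density_frontier E \<subseteq> {x. x \<bullet> w = 0}"
    using frontier_subset_hyperplane[OF closed_empty E_lower E_upper] by (simp add: density_frontier_def)
  then have "oplus_ball (density_frontier E) r \<subseteq> {x. \<bar>x \<bullet> w\<bar> < r}"
    using oplus_ball_hyperplane_subset[OF w, of r] by (auto simp: oplus_ball_def)
  then have "emeasure lborel (oplus_ball (density_frontier E) r \<inter> ball c R)
      \<le> emeasure lborel ({x. \<bar>x \<bullet> w\<bar> < r} \<inter> ball c R)"
    by (intro emeasure_mono) (auto intro!: borel_open open_Int open_Collect_less continuous_intros)
  also have "\<dots> \<le> emeasure lborel (oplus_ball (density_frontier F) r \<inter> ball c R)"
    unfolding density_frontier_def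
    using slab_le_oplus_ball_frontier[OF r w] F_lower F_upper by (simp add: K_def)
  finally show ?thesis
    unfolding Per_eq_lborel[OF open_ball] E_def by (rule mult_left_mono) simp
qed

text \<open>
  For \<open>\<omega> = 0\<close> the set is empty and has perimeter zero; otherwise only the direction of \<open>\<omega>\<close> matters.
\<close>

theorem proposition1p10:
  fixes r :: real and \<omega> :: "real^'n" and E :: "(real^'n) set"
  assumes "r > 0"
    and "E = {x. x \<bullet> \<omega> < 0}"
  shows "class_A_minimizer r E"
proof -
  have "open E"
    unfolding assms(2) by (intro open_Collect_less continuous_intros)
  then have E: "E \<in> sets lebesgue"
    by simp
  have "Per r E (ball c R) \<le> Per r F (ball c R)"
    if R: "R > 0" and F: "F \<in> sets lebesgue"
      and ae: "AE x in lebesgue. x \<in> F - ominus_ball (ball c R) r \<longleftrightarrow> x \<in> E - ominus_ball (ball c R) r"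
    for c R and F :: "(real^'n) set"
  proof (cases "\<omega> = 0")
    case True
    then have "E = {}"
      by (simp add: assms(2))
    then have "density_points E = {}"
      using not_in_density_points_if_AE[OF E open_UNIV] by auto
    then show ?thesis
      by (simp add: Per_def density_frontier_def oplus_ball_def)
  next
    case False
    define w where "w = sgn \<omega>"
    have w: "norm w = 1"
      using False by (simp add: w_def norm_sgn)
    have E_eq: "E = {x. x \<bullet> w < 0}"
      using False by (simp add: assms(2) w_def sgn_div_norm mult_less_0_iff)
    have "AE x in lebesgue. x \<notin> cball c (R - r) \<longrightarrow> (x \<in> F \<longleftrightarrow> x \<bullet> w < 0)"
      using ae by eventually_elim (use ominus_ball_ball_subset[OF R, of c r] in \<open>auto simp: E_eq\<close>)
    then show ?thesis
      unfolding E_eq by (rule Per_halfspace_le[OF assms(1) w F])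
  qed
  then show ?thesis
    using E by (auto simp: class_A_minimizer_def Per_minimizer_def)
qed

end
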